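(* A test $\phi$ is said to be locally unbiased (LU) if $$E_{\beta_0,\mu}\phi(S,T)=\alpha\quad\text{and}\quad E_{\beta_0,\mu}\,\phi(S,T)\,S'C_{\beta_0}\mu=0\quad\text{for all }\mu .$$ If a test is unbiased, then it is LU.
   Context: Fix $k\ge1$, $\beta_0\in\mathbb{R}$, $\alpha\in(0,1)$ and a symmetric positive definite $2k\times 2k$ matrix $\Sigma$. For $\beta\in\mathbb{R}$ write $a=(\beta,1)'$, $a_0=(\beta_0,1)'$, $b_0=(1,-\beta_0)'$. Define $$C_{\beta_0}=[(b_0'\otimes I_k)\Sigma(b_0\otimes I_k)]^{-1/2},\qquad D_\beta=[(a_0'\otimes I_k)\Sigma^{-1}(a_0\otimes I_k)]^{-1/2}(a_0'\otimes I_k)\Sigma^{-1}(a\otimes I_k).$$ The parameter is $(\beta,\mu)\in\mathbb{R}\times\mathbb{R}^k$. Under $(\beta,\mu)$, $S\sim N((\beta-\beta_0)C_{\beta_0}\mu,I_k)$ and $T\sim N(D_\beta\mu,I_k)$ are independent, and $E_{\beta,\mu}$ denotes the corresponding expectation. The problem is to test $H_0:\beta=\beta_0$ against $H_1:\beta\neq\beta_0$ at level $\alpha$, with $\mu$ a nuisance parameter. A test is a measurable $\phi:\mathbb{R}^k\times\mathbb{R}^k\to[0,1]$. It is unbiased (at level $\alpha$) if $E_{\beta_0,\mu}\phi(S,T)\le\alpha$ for all $\mu$ and $E_{\beta,\mu}\phi(S,T)\ge\alpha$ for all $\beta\neq\beta_0$ and all $\mu$. *)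

theory Defs
  imports "HOL-Probability.Probability"
begin

text \<open>
  Throughout, \<open>k\<close> is the cardinality of the index type \<open>'k\<close>, and matrices of order \<open>2k\<close> are
  indexed by \<open>2 \<times> 'k\<close>: the first component selects the block, the second one the position
  inside the block, as is usual for Kronecker products.
\<close>

definition sym_pos_def :: "real^'n^'n \<Rightarrow> bool" where
  "sym_pos_def A \<longleftrightarrow> transpose A = A \<and> (\<forall>x. x \<noteq> 0 \<longrightarrow> x \<bullet> (A *v x) > 0)"

text \<open>The power \<open>A\<^sup>-\<^sup>1\<^sup>/\<^sup>2\<close> of a symmetric positive definite matrix \<open>A\<close>: the unique symmetric positive
  definite square root of the inverse of \<open>A\<close>.\<close>

definition inv_sqrt_mat :: "real^'n^'n \<Rightarrow> real^'n^'n" where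
  "inv_sqrt_mat A = (THE B. sym_pos_def B \<and> B ** B = matrix_inv A)"

text \<open>\<open>kron_col v A\<close> is the Kronecker product of the column vector \<open>v\<close> with \<open>A\<close>, and
  \<open>kron_row v A\<close> that of the row vector \<open>v'\<close> with \<open>A\<close>.\<close>

definition kron_col :: "real^'m \<Rightarrow> real^'q^'p \<Rightarrow> real^'q^('m \<times> 'p)" where
  "kron_col v A = (\<chi> i j. v $ fst i * A $ snd i $ j)"

definition kron_row :: "real^'m \<Rightarrow> real^'q^'p \<Rightarrow> real^('m \<times> 'q)^'p" where
  "kron_row v A = (\<chi> i j. v $ fst j * A $ i $ snd j)"

definition a_vec :: "real \<Rightarrow> real^2" where
  "a_vec \<beta> = vector [\<beta>, 1]"

definition b_vec :: "real \<Rightarrow> real^2" where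
  "b_vec \<beta> = vector [1, - \<beta>]"

definition C_mat :: "real^(2 \<times> 'k)^(2 \<times> 'k) \<Rightarrow> real \<Rightarrow> real^'k^'k" where
  "C_mat \<Sigma> \<beta>0 =
     inv_sqrt_mat (kron_row (b_vec \<beta>0) (mat 1) ** \<Sigma> ** kron_col (b_vec \<beta>0) (mat 1))"

definition D_mat :: "real^(2 \<times> 'k)^(2 \<times> 'k) \<Rightarrow> real \<Rightarrow> real \<Rightarrow> real^'k^'k" where
  "D_mat \<Sigma> \<beta>0 \<beta> =
     inv_sqrt_mat
       (kron_row (a_vec \<beta>0) (mat 1) ** matrix_inv \<Sigma> ** kron_col (a_vec \<beta>0) (mat 1))
     ** (kron_row (a_vec \<beta>0) (mat 1) ** matrix_inv \<Sigma> ** kron_col (a_vec \<beta>) (mat 1))"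

text \<open>The normal distribution \<open>N(m, I)\<close>; its Lebesgue density is the product of the densities of
  the independent coordinates \<open>N(m\<^sub>i, 1)\<close>.\<close>

definition normal_id :: "real^'k \<Rightarrow> (real^'k) measure" where
  "normal_id m = density lborel (\<lambda>x. ennreal (\<Prod>i\<in>UNIV. normal_density (m $ i) 1 (x $ i)))"

text \<open>The joint law of \<open>(S, T)\<close> under \<open>(\<beta>, \<mu>)\<close>.\<close>

definition ST_law ::
  "real^(2 \<times> 'k)^(2 \<times> 'k) \<Rightarrow> real \<Rightarrow> real \<Rightarrow> real^'k \<Rightarrow> ((real^'k) \<times> (real^'k)) measure" where
  "ST_law \<Sigma> \<beta>0 \<beta> \<mu> =
     normal_id ((\<beta> - \<beta>0) *\<^sub>R (C_mat \<Sigma> \<beta>0 *v \<mu>)) \<Otimes>\<^sub>M normal_id (D_mat \<Sigma> \<beta>0 \<beta> *v \<mu>)"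

definition is_test :: "((real^'k) \<times> (real^'k) \<Rightarrow> real) \<Rightarrow> bool" where
  "is_test \<phi> \<longleftrightarrow> \<phi> \<in> borel_measurable (borel \<Otimes>\<^sub>M borel) \<and> (\<forall>z. 0 \<le> \<phi> z \<and> \<phi> z \<le> 1)"

definition unbiased_test ::
  "real^(2 \<times> 'k)^(2 \<times> 'k) \<Rightarrow> real \<Rightarrow> real \<Rightarrow> ((real^'k) \<times> (real^'k) \<Rightarrow> real) \<Rightarrow> bool" where
  "unbiased_test \<Sigma> \<beta>0 \<alpha> \<phi> \<longleftrightarrow>
     (\<forall>\<mu>. (LINT z|ST_law \<Sigma> \<beta>0 \<beta>0 \<mu>. \<phi> z) \<le> \<alpha>) \<and>
     (\<forall>\<beta> \<mu>. \<beta> \<noteq> \<beta>0 \<longrightarrow> (LINT z|ST_law \<Sigma> \<beta>0 \<beta> \<mu>. \<phi> z) \<ge> \<alpha>)"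

definition locally_unbiased_test ::
  "real^(2 \<times> 'k)^(2 \<times> 'k) \<Rightarrow> real \<Rightarrow> real \<Rightarrow> ((real^'k) \<times> (real^'k) \<Rightarrow> real) \<Rightarrow> bool" where
  "locally_unbiased_test \<Sigma> \<beta>0 \<alpha> \<phi> \<longleftrightarrow>
     (\<forall>\<mu>. (LINT z|ST_law \<Sigma> \<beta>0 \<beta>0 \<mu>. \<phi> z) = \<alpha> \<and>
          (LINT z|ST_law \<Sigma> \<beta>0 \<beta>0 \<mu>. \<phi> z * (fst z \<bullet> (C_mat \<Sigma> \<beta>0 *v \<mu>))) = 0)"

end

theory Submission
  imports Defs
begin

text \<open>
  Write \<open>A = (a\<^sub>0' \<otimes> I) \<Sigma>\<^sup>-\<^sup>1 (a\<^sub>0 \<otimes> I)\<close>. Since \<open>a\<close> is affine in \<open>\<beta>\<close>, for fixed \<open>\<mu>\<close> the mean of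
  \<open>(S, T)\<close> moves along the straight line \<open>u\<^sub>0 + (\<beta> - \<beta>\<^sub>0) w\<close> with \<open>u\<^sub>0 = (0, D \<mu>)\<close> and
  \<open>w = (C \<mu>, M \<mu>)\<close>, where \<open>D\<close> is the value of \<open>D\<^sub>\<beta>\<close> at \<open>\<beta>\<^sub>0\<close> and \<open>M\<close> is its constant slope.

  A Gaussian shift by \<open>h w\<close> multiplies the density by \<open>exp (h y - h\<^sup>2 |w|\<^sup>2 / 2)\<close>, where
  \<open>y z = w \<bullet> (z - u\<^sub>0)\<close>. So the power along any line is, up to a smooth factor, a two-sided Laplace
  transform. It is differentiable at \<open>h = 0\<close> with derivative \<open>E (\<phi> y)\<close>
  (\<open>DERIV_power_along_line\<close>).

  Unbiasedness says that the power is at most \<open>\<alpha>\<close> at \<open>h = 0\<close> and at least \<open>\<alpha>\<close> elsewhere. By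
  continuity it equals \<open>\<alpha>\<close> at \<open>h = 0\<close>, for every \<open>\<mu>\<close>, and it has a minimum there; so its derivative
  vanishes:
  \<open>E (\<phi> (S \<bullet> C \<mu>)) + E (\<phi> ((T - D \<mu>) \<bullet> M \<mu>)) = 0\<close>.
  The second term is the derivative of the power along the line with direction \<open>(0, M \<mu>)\<close>. That line
  stays in the null hypothesis: \<open>D\<close> and \<open>M\<close> have the same left factor \<open>A\<^sup>-\<^sup>1\<^sup>/\<^sup>2\<close>, and the right factor
  \<open>A\<close> of \<open>D\<close> is invertible, so \<open>M \<mu> = D \<nu>\<close> for some \<open>\<nu>\<close> (\<open>D_slope_in_range\<close>). The power is
  constantly \<open>\<alpha>\<close> there, so the second term is zero, and so is the first.
\<close>

section \<open>Laplace transforms of bounded weights\<close>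

lemma exp_taylor1_bound:
  fixes h y :: real
  assumes "\<bar>h\<bar> \<le> 1"
  shows "\<bar>exp (h * y) - 1 - h * y\<bar> \<le> h\<^sup>2 * (2 * (exp (2 * y) + exp (- 2 * y)))"
proof -
  have "\<bar>exp (h * y) - 1 - h * y\<bar> \<le> exp \<bar>h * y\<bar> * \<bar>h * y\<bar>\<^sup>2"
    using Taylor_exp_field[of "h * y" 1] by (simp add: algebra_simps power2_eq_square)
  also have "\<dots> \<le> exp \<bar>y\<bar> * \<bar>h * y\<bar>\<^sup>2"
    using assms by (intro mult_right_mono) (auto simp: abs_mult intro: mult_left_le_one_le)
  also have "\<dots> = h\<^sup>2 * (y\<^sup>2 * exp \<bar>y\<bar>)"
    by (simp add: power_mult_distrib)
  also have "\<dots> \<le> h\<^sup>2 * (2 * exp \<bar>y\<bar> * exp \<bar>y\<bar>)"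
  proof (intro mult_left_mono mult_right_mono)
    show "y\<^sup>2 \<le> 2 * exp \<bar>y\<bar>"
      using exp_lower_Taylor_quadratic[of "\<bar>y\<bar>"] by auto
  qed auto
  also have "\<dots> = h\<^sup>2 * (2 * exp (2 * \<bar>y\<bar>))"
    by (simp flip: exp_add)
  also have "\<dots> \<le> h\<^sup>2 * (2 * (exp (2 * y) + exp (- 2 * y)))"
    by (intro mult_left_mono) (auto simp: abs_if)
  finally show ?thesis .
qed

text \<open>The exponential moments at \<open>2\<close> and \<open>-2\<close>
  dominate the second-order Taylor remainder, uniformly for \<open>|h| \<le> 1\<close>.\<close>

lemma DERIV_laplace_at_0:
  fixes \<phi> y :: "'a \<Rightarrow> real"
  assumes \<phi>[measurable]: "\<phi> \<in> borel_measurable Q" and bounded: "\<And>z. 0 \<le> \<phi> z \<and> \<phi> z \<le> 1"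
    and y[measurable]: "y \<in> borel_measurable Q"
    and exp_int: "\<And>h. integrable Q (\<lambda>z. exp (h * y z))"
  shows "integrable Q (\<lambda>z. \<phi> z * y z)"
    and "((\<lambda>h. LINT z|Q. \<phi> z * exp (h * y z)) has_real_derivative (LINT z|Q. \<phi> z * y z)) (at 0)"
proof -
  let ?g = "\<lambda>h. LINT z|Q. \<phi> z * exp (h * y z)"
  let ?b = "\<lambda>z. 2 * (exp (2 * y z) + exp (- 2 * y z))"
  define m where "m = (LINT z|Q. \<phi> z * y z)"
  have b_int: "integrable Q ?b"
    using exp_int[of 2] exp_int[of "-2"] by auto
  have weighted_int: "integrable Q (\<lambda>z. \<phi> z * f z)"
    if "integrable Q f" for f :: "'a \<Rightarrow> real"
  proof (rule Bochner_Integration.integrable_bound[OF that])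
    show "(\<lambda>z. \<phi> z * f z) \<in> borel_measurable Q"
      using that by measurable
    show "AE z in Q. norm (\<phi> z * f z) \<le> norm (f z)"
      using bounded by (auto simp: abs_mult intro!: mult_left_le_one_le)
  qed
  have remainder: "\<bar>exp (h * y z) - 1 - h * y z\<bar> \<le> h\<^sup>2 * ?b z" if "\<bar>h\<bar> \<le> 1" for h z
    by (rule exp_taylor1_bound[OF that])
  have rem_int: "integrable Q (\<lambda>z. exp (1 * y z) - 1 - 1 * y z)"
  proof (rule Bochner_Integration.integrable_bound[OF b_int])
    show "AE z in Q. norm (exp (1 * y z) - 1 - 1 * y z) \<le> norm (?b z)"
      using remainder[of 1] by (auto simp del: mult_1)
  qed measurable
  have const_int: "integrable Q (\<lambda>z. 1 :: real)"
    using exp_int[of 0] by simp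
  have y_int: "integrable Q y"
    using Bochner_Integration.integrable_diff[OF
        Bochner_Integration.integrable_diff[OF exp_int[of 1] const_int] rem_int]
    by simp
  show \<phi>y_int: "integrable Q (\<lambda>z. \<phi> z * y z)"
    by (rule weighted_int[OF y_int])
  \<comment> \<open>The quadratic remainder bound gives an error of order \<open>h\<close> in the difference quotient.\<close>
  have bound: "\<bar>?g h - ?g 0 - h * m\<bar> \<le> h\<^sup>2 * (LINT z|Q. ?b z)" if h: "\<bar>h\<bar> \<le> 1" for h
  proof -
    let ?r = "\<lambda>z. \<phi> z * exp (h * y z) - \<phi> z * exp (0 * y z) - h * (\<phi> z * y z)"
    have r_int: "integrable Q ?r"
      using weighted_int[OF exp_int[of h]] weighted_int[OF exp_int[of 0]] \<phi>y_int
      by (intro Bochner_Integration.integrable_diff integrable_mult_right) auto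
    have r_bound: "\<bar>?r z\<bar> \<le> h\<^sup>2 * ?b z" for z
    proof -
      have "?r z = \<phi> z * (exp (h * y z) - 1 - h * y z)"
        by (simp add: algebra_simps)
      then have "\<bar>?r z\<bar> = \<phi> z * \<bar>exp (h * y z) - 1 - h * y z\<bar>"
        using bounded[of z] by (simp only: abs_mult abs_of_nonneg)
      also have "\<dots> \<le> \<bar>exp (h * y z) - 1 - h * y z\<bar>"
        using bounded[of z] by (intro mult_left_le_one_le) auto
      also have "\<dots> \<le> h\<^sup>2 * ?b z"
        by (rule remainder[OF h])
      finally show ?thesis .
    qed
    have "?g h - ?g 0 - h * m = integral\<^sup>L Q ?r"
      unfolding m_def
      using weighted_int[OF exp_int[of h]] weighted_int[OF exp_int[of 0]] \<phi>y_int
      by simp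
    then have "\<bar>?g h - ?g 0 - h * m\<bar> = \<bar>integral\<^sup>L Q ?r\<bar>"
      by (rule arg_cong)
    also have "\<dots> \<le> (LINT z|Q. \<bar>?r z\<bar>)"
      by (rule integral_abs_bound)
    also have "\<dots> \<le> (LINT z|Q. h\<^sup>2 * ?b z)"
      by (rule integral_mono[OF integrable_abs[OF r_int] integrable_mult_right[OF b_int] r_bound])
    finally show ?thesis by simp
  qed
  show "(?g has_real_derivative (LINT z|Q. \<phi> z * y z)) (at 0)"
    unfolding DERIV_def m_def[symmetric]
  proof (rule LIM_zero_cancel, rule Lim_null_comparison)
    show "\<forall>\<^sub>F h in at 0. norm ((?g (0 + h) - ?g 0) / h - m) \<le> \<bar>h\<bar> * (LINT z|Q. ?b z)"
      unfolding eventually_at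
    proof (intro exI[of _ 1] conjI ballI impI)
      fix h :: real
      assume "h \<noteq> 0 \<and> dist h 0 < 1"
      then have h: "h \<noteq> 0" "\<bar>h\<bar> \<le> 1" by auto
      have "\<bar>h\<bar> * norm ((?g (0 + h) - ?g 0) / h - m) = \<bar>?g h - ?g 0 - h * m\<bar>"
        using h(1) by (simp add: field_simps flip: abs_mult)
      also have "\<dots> \<le> \<bar>h\<bar> * (\<bar>h\<bar> * (LINT z|Q. ?b z))"
        using bound[OF h(2)] by (simp add: power2_eq_square flip: mult.assoc)
      finally show "norm ((?g (0 + h) - ?g 0) / h - m) \<le> \<bar>h\<bar> * (LINT z|Q. ?b z)"
        by (rule mult_left_le_imp_le) (use h(1) in simp)
    qed simp
    show "((\<lambda>h. \<bar>h\<bar> * (LINT z|Q. ?b z)) \<longlongrightarrow> 0) (at 0)"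
      by (auto intro!: tendsto_eq_intros)
  qed
qed

section \<open>Shifts of Gaussian laws with identity covariance\<close>

lemma sets_normal_id [measurable_cong, simp]: "sets (normal_id m) = sets borel"
  by (simp add: normal_id_def)

lemma prob_space_normal_id: "prob_space (normal_id (m :: real^'k))"
proof
  have "emeasure (normal_id m) (space (normal_id m))
      = (\<integral>\<^sup>+x. (\<Prod>i\<in>UNIV. ennreal (normal_density (m $ i) 1 (x $ i))) \<partial>lborel)"
    by (simp add: normal_id_def emeasure_density prod_ennreal)
  also have "\<dots> = (\<integral>\<^sup>+x. (\<Prod>b\<in>Basis. ennreal (normal_density (m \<bullet> b) 1 (x \<bullet> b))) \<partial>lborel)"
  proof -
    have Basis_eq: "(Basis :: (real^'k) set) = (\<lambda>i. axis i 1) ` UNIV"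
      by (auto simp: Basis_vec_def)
    have "inj (\<lambda>i. axis i (1::real) :: real^'k)"
      by (auto simp: inj_on_def axis_eq_axis)
    then show ?thesis
      by (simp add: Basis_eq prod.reindex inner_axis)
  qed
  also have "\<dots> = (\<Prod>b\<in>(Basis :: (real^'k) set). \<integral>\<^sup>+x. ennreal (normal_density (m \<bullet> b) 1 x) \<partial>lborel)"
    by (rule nn_integral_lborel_prod) auto
  also have "\<dots> = 1"
  proof (rule prod.neutral, rule)
    fix b :: "real^'k"
    interpret prob_space "density lborel (\<lambda>x. ennreal (normal_density (m \<bullet> b) 1 x))"
      by (rule prob_space_normal_density) simp
    show "(\<integral>\<^sup>+x. ennreal (normal_density (m \<bullet> b) 1 x) \<partial>lborel) = 1"
      using emeasure_space_1 by (simp add: emeasure_density)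
  qed
  finally show "emeasure (normal_id m) (space (normal_id m)) = 1" .
qed

lemma normal_density_shift:
  "normal_density (m + w) 1 x = normal_density m 1 x * exp (w * (x - m) - w\<^sup>2 / 2)"
  by (simp add: normal_density_def field_simps power2_eq_square flip: exp_add)

lemma normal_id_shift:
  "normal_id (m + w) = density (normal_id m) (\<lambda>x. ennreal (exp (w \<bullet> (x - m) - (w \<bullet> w) / 2)))"
proof -
  have "(\<Prod>i\<in>UNIV. normal_density ((m + w) $ i) 1 (x $ i))
      = (\<Prod>i\<in>UNIV. normal_density (m $ i) 1 (x $ i)) * exp (w \<bullet> (x - m) - (w \<bullet> w) / 2)" for x
    by (simp add: normal_density_shift prod.distrib inner_vec_def sum_subtractf power2_eq_square
        flip: exp_sum sum_divide_distrib)
  then show ?thesis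
    unfolding normal_id_def
    by (subst density_density_eq) (auto simp: ennreal_mult prod_nonneg)
qed

definition normal_pair :: "(real^'k) \<times> (real^'k) \<Rightarrow> ((real^'k) \<times> (real^'k)) measure" where
  "normal_pair u = normal_id (fst u) \<Otimes>\<^sub>M normal_id (snd u)"

lemma sets_normal_pair [measurable_cong, simp]: "sets (normal_pair u) = sets borel"
  unfolding normal_pair_def borel_prod[symmetric] by (intro sets_pair_measure_cong) auto

lemma prob_space_normal_pair: "prob_space (normal_pair u)"
  unfolding normal_pair_def by (intro prob_space_pair prob_space_normal_id)

lemma normal_pair_shift:
  "normal_pair (u + w) =
     density (normal_pair u) (\<lambda>z. ennreal (exp (w \<bullet> (z - u) - (w \<bullet> w) / 2)))"
proof -
  let ?L = "\<lambda>w m x. ennreal (exp (w \<bullet> (x - m) - (w \<bullet> w) / 2))"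
  have "normal_pair (u + w) =
      density (normal_id (fst u)) (?L (fst w) (fst u)) \<Otimes>\<^sub>M
      density (normal_id (snd u)) (?L (snd w) (snd u))"
    unfolding normal_pair_def by (simp add: normal_id_shift)
  also have "\<dots> = density (normal_pair u)
      (\<lambda>(s, t). ?L (fst w) (fst u) s * ?L (snd w) (snd u) t)"
    unfolding normal_pair_def
    by (intro pair_measure_density)
      (auto intro!: prob_space_imp_sigma_finite prob_space_normal_id simp flip: normal_id_shift)
  also have "\<dots> = density (normal_pair u) (?L w u)"
  proof (rule arg_cong[where f = "density (normal_pair u)"], rule ext)
    fix z
    have "w \<bullet> (z - u) - (w \<bullet> w) / 2 =
        (fst w \<bullet> (fst z - fst u) - (fst w \<bullet> fst w) / 2) + (snd w \<bullet> (snd z - snd u) - (snd w \<bullet> snd w) / 2)"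
      by (simp add: inner_prod_def add_divide_distrib)
    then show "(case z of (s, t) \<Rightarrow> ?L (fst w) (fst u) s * ?L (snd w) (snd u) t) = ?L w u z"
      by (simp only: exp_add ennreal_mult'' exp_ge_zero case_prod_beta)
  qed
  finally show ?thesis .
qed

text \<open>Exponential moments come for free from the shift formula: up to a constant factor, the
  function \<open>exp (h * (w \<bullet> (z - u)))\<close> is the density of another probability measure.\<close>

lemma integrable_exp_normal_pair:
  "integrable (normal_pair u) (\<lambda>z. exp (h * (w \<bullet> (z - u))))"
proof -
  interpret prob_space "normal_pair (u + h *\<^sub>R w)"
    by (rule prob_space_normal_pair)
  have "integrable (normal_pair (u + h *\<^sub>R w)) (\<lambda>z. 1 :: real)"
    by simp
  then have "integrable (normal_pair u) (\<lambda>z. exp (h * (w \<bullet> (z - u)) - h\<^sup>2 * (w \<bullet> w) / 2))"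
    unfolding normal_pair_shift
    by (subst (asm) integrable_density) (auto simp: power2_eq_square mult.assoc)
  then have "integrable (normal_pair u)
      (\<lambda>z. exp (h\<^sup>2 * (w \<bullet> w) / 2) * exp (h * (w \<bullet> (z - u)) - h\<^sup>2 * (w \<bullet> w) / 2))"
    by (rule integrable_mult_right)
  then show ?thesis
    by (simp flip: exp_add)
qed

lemma integral_normal_pair_line:
  fixes \<phi> :: "(real^'k) \<times> (real^'k) \<Rightarrow> real"
  assumes [measurable]: "\<phi> \<in> borel_measurable borel"
  shows "(LINT z|normal_pair (u + h *\<^sub>R w). \<phi> z) =
    exp (- (h\<^sup>2 * (w \<bullet> w) / 2)) * (LINT z|normal_pair u. \<phi> z * exp (h * (w \<bullet> (z - u))))"
proof -
  have "(LINT z|normal_pair (u + h *\<^sub>R w). \<phi> z) =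
      (LINT z|normal_pair u. exp (h * (w \<bullet> (z - u)) - h\<^sup>2 * (w \<bullet> w) / 2) * \<phi> z)"
    unfolding normal_pair_shift
    by (subst integral_density) (auto simp: power2_eq_square mult.assoc)
  also have "\<dots> = (LINT z|normal_pair u.
      exp (- (h\<^sup>2 * (w \<bullet> w) / 2)) * (\<phi> z * exp (h * (w \<bullet> (z - u)))))"
    by (intro Bochner_Integration.integral_cong) (simp_all add: mult_ac flip: exp_add)
  finally show ?thesis
    by simp
qed

text \<open>The exponential prefactor equals \<open>1\<close> and is stationary at \<open>h = 0\<close>, so only the Laplace
  transform contributes to the derivative.\<close>

lemma DERIV_power_along_line:
  fixes \<phi> :: "(real^'k) \<times> (real^'k) \<Rightarrow> real"
  assumes [measurable]: "\<phi> \<in> borel_measurable borel" and bounded: "\<And>z. 0 \<le> \<phi> z \<and> \<phi> z \<le> 1"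
  shows "integrable (normal_pair u) (\<lambda>z. \<phi> z * (w \<bullet> (z - u)))"
    and "((\<lambda>h. LINT z|normal_pair (u + h *\<^sub>R w). \<phi> z) has_real_derivative
           (LINT z|normal_pair u. \<phi> z * (w \<bullet> (z - u)))) (at 0)"
proof -
  have meas: "\<phi> \<in> borel_measurable (normal_pair u)"
    "(\<lambda>z. w \<bullet> (z - u)) \<in> borel_measurable (normal_pair u)"
    by measurable
  note laplace = DERIV_laplace_at_0[OF meas(1) bounded meas(2) integrable_exp_normal_pair]
  show "integrable (normal_pair u) (\<lambda>z. \<phi> z * (w \<bullet> (z - u)))"
    by (rule laplace(1))
  have "((\<lambda>h. exp (- (h\<^sup>2 * (w \<bullet> w) / 2))) has_real_derivative 0) (at 0)"
    by (auto intro!: derivative_eq_intros)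
  from DERIV_mult[OF this laplace(2)]
  show "((\<lambda>h. LINT z|normal_pair (u + h *\<^sub>R w). \<phi> z) has_real_derivative
           (LINT z|normal_pair u. \<phi> z * (w \<bullet> (z - u)))) (at 0)"
    by (simp add: integral_normal_pair_line)
qed

section \<open>The mean of the second statistic as a function of the structural parameter\<close>

lemma kron_row_eq_transpose: "kron_row v (mat 1) = transpose (kron_col v (mat 1))"
  by (auto simp: kron_row_def kron_col_def transpose_def mat_def vec_eq_iff)

lemma kron_col_mult: "(kron_col v (mat 1) *v x) $ (i, j) = v $ i * x $ j"
  by (simp add: kron_col_def matrix_vector_mult_def mat_def if_distrib[of "\<lambda>c. _ * c * _"]
      if_distrib[of "\<lambda>c. _ * c"] if_distrib[of "\<lambda>c. c * _"] cong: if_cong)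

lemma kron_col_a_vec_affine:
  fixes x :: "real^'k"
  shows "kron_col (a_vec (\<beta>0 + h)) (mat 1) *v x =
     kron_col (a_vec \<beta>0) (mat 1) *v x + h *\<^sub>R (kron_col (vector [1, 0]) (mat 1) *v x)"
proof -
  have "(a_vec (\<beta>0 + h)) $ i = a_vec \<beta>0 $ i + h * (vector [1, 0] :: real^2) $ i" for i
    by (cases i rule: exhaust_2[THEN disjE]) (auto simp: a_vec_def)
  then show ?thesis
    by (auto simp: vec_eq_iff kron_col_mult algebra_simps)
qed

definition A_mat :: "real^(2 \<times> 'k)^(2 \<times> 'k) \<Rightarrow> real \<Rightarrow> real^'k^'k" where
  "A_mat \<Sigma> \<beta>0 =
     kron_row (a_vec \<beta>0) (mat 1) ** matrix_inv \<Sigma> ** kron_col (a_vec \<beta>0) (mat 1)"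

definition D_slope :: "real^(2 \<times> 'k)^(2 \<times> 'k) \<Rightarrow> real \<Rightarrow> real^'k^'k" where
  "D_slope \<Sigma> \<beta>0 = inv_sqrt_mat (A_mat \<Sigma> \<beta>0) **
     (kron_row (a_vec \<beta>0) (mat 1) ** matrix_inv \<Sigma> ** kron_col (vector [1, 0]) (mat 1))"

lemma D_mat_affine:
  "D_mat \<Sigma> \<beta>0 (\<beta>0 + h) *v \<mu> = D_mat \<Sigma> \<beta>0 \<beta>0 *v \<mu> + h *\<^sub>R (D_slope \<Sigma> \<beta>0 *v \<mu>)"
  unfolding D_mat_def D_slope_def A_mat_def
  by (simp add: kron_col_a_vec_affine matrix_vector_right_distrib matrix_vector_mult_scaleR
      flip: matrix_vector_mul_assoc)

lemma inj_sym_pos_def: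
  assumes "sym_pos_def \<Sigma>"
  shows "inj ((*v) \<Sigma>)"
proof (rule injI)
  fix x y
  assume "\<Sigma> *v x = \<Sigma> *v y"
  then have "\<Sigma> *v (x - y) = 0"
    by (simp add: matrix_vector_mult_diff_distrib)
  then have "\<not> (x - y) \<bullet> (\<Sigma> *v (x - y)) > 0" by simp
  then show "x = y"
    using assms unfolding sym_pos_def_def by (metis eq_iff_diff_eq_0)
qed

lemma sym_pos_def_mult_matrix_inv:
  assumes "sym_pos_def \<Sigma>"
  shows "\<Sigma> ** matrix_inv \<Sigma> = mat 1"
proof -
  have "invertible \<Sigma>"
    using inj_sym_pos_def[OF assms]
    by (simp add: invertible_left_inverse matrix_left_invertible_injective)
  then show ?thesis
    unfolding invertible_def matrix_inv_def by (rule someI2_ex) simp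
qed

text \<open>With \<open>y = (a\<^sub>0 \<otimes> I) x\<close> and \<open>z = \<Sigma>\<^sup>-\<^sup>1 y\<close>, the quadratic form of \<open>A\<close> at \<open>x\<close> is
  \<open>z \<bullet> \<Sigma> z\<close>, which vanishes only for \<open>y = 0\<close>. The second block of \<open>y\<close> is \<open>x\<close> itself because the
  second entry of \<open>a\<^sub>0\<close> is \<open>1\<close>.\<close>

lemma surj_A_mat:
  fixes \<Sigma> :: "real^(2 \<times> 'k::finite)^(2 \<times> 'k)"
  assumes "sym_pos_def \<Sigma>"
  shows "surj ((*v) (A_mat \<Sigma> \<beta>0))"
proof -
  let ?K = "kron_col (a_vec \<beta>0) (mat 1) :: real^'k^(2 \<times> 'k)"
  have trivial_kernel: "x = 0" if "A_mat \<Sigma> \<beta>0 *v x = 0" for x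
  proof -
    define z where "z = matrix_inv \<Sigma> *v (?K *v x)"
    have \<Sigma>z: "\<Sigma> *v z = ?K *v x"
      unfolding z_def
      by (simp only: matrix_vector_mul_assoc[of \<Sigma>] sym_pos_def_mult_matrix_inv[OF assms] matrix_vector_mul_lid)
    have "A_mat \<Sigma> \<beta>0 *v x = transpose ?K *v z"
      unfolding A_mat_def z_def kron_row_eq_transpose by (simp flip: matrix_vector_mul_assoc)
    then have "0 = x \<bullet> (transpose ?K *v z)"
      using that by simp
    also have "\<dots> = (?K *v x) \<bullet> z"
      by (metis dot_lmul_matrix inner_commute transpose_matrix_vector transpose_transpose)
    finally have "z \<bullet> (\<Sigma> *v z) = 0"
      by (simp add: \<Sigma>z inner_commute)
    then have "z = 0"
      using assms unfolding sym_pos_def_def by force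
    then have "?K *v x = 0"
      using \<Sigma>z by simp
    then have "(?K *v x) $ (2, i) = 0" for i
      by simp
    then show "x = 0"
      by (simp add: kron_col_mult a_vec_def vec_eq_iff)
  qed
  have "inj ((*v) (A_mat \<Sigma> \<beta>0))"
    using trivial_kernel by (metis (no_types) injI eq_iff_diff_eq_0 matrix_vector_mult_diff_distrib)
  then show ?thesis
    by (metis matrix_left_invertible_injective matrix_left_right_inverse matrix_right_invertible_surjective)
qed

text \<open>Both matrices have the left factor \<open>A\<^sup>-\<^sup>1\<^sup>/\<^sup>2\<close>, so it suffices to match the right factors, and
  the right factor \<open>A\<close> of \<open>D\<close> is surjective.\<close>

lemma D_slope_in_range:
  assumes "sym_pos_def \<Sigma>"
  obtains \<nu> where "D_slope \<Sigma> \<beta>0 *v \<mu> = D_mat \<Sigma> \<beta>0 \<beta>0 *v \<nu>"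
proof -
  obtain \<nu> where \<nu>: "A_mat \<Sigma> \<beta>0 *v \<nu> =
      (kron_row (a_vec \<beta>0) (mat 1) ** matrix_inv \<Sigma> ** kron_col (vector [1, 0]) (mat 1)) *v \<mu>"
    using surj_A_mat[OF assms] by (metis surjD)
  have "D_mat \<Sigma> \<beta>0 \<beta>0 *v \<nu> = inv_sqrt_mat (A_mat \<Sigma> \<beta>0) *v (A_mat \<Sigma> \<beta>0 *v \<nu>)"
    unfolding D_mat_def A_mat_def by (simp only: matrix_vector_mul_assoc)
  also have "\<dots> = D_slope \<Sigma> \<beta>0 *v \<mu>"
    unfolding \<nu> D_slope_def by (simp only: matrix_vector_mul_assoc)
  finally show thesis
    using that by metis
qed

lemma ST_law_line:
  "ST_law \<Sigma> \<beta>0 (\<beta>0 + h) \<mu> =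
     normal_pair ((0, D_mat \<Sigma> \<beta>0 \<beta>0 *v \<mu>) + h *\<^sub>R (C_mat \<Sigma> \<beta>0 *v \<mu>, D_slope \<Sigma> \<beta>0 *v \<mu>))"
  unfolding ST_law_def normal_pair_def by (simp add: D_mat_affine)

section \<open>Unbiasedness forces local unbiasedness\<close>

theorem proposition4:
  fixes \<Sigma> :: "real^(2 \<times> 'k::finite)^(2 \<times> 'k)"
    and \<beta>0 \<alpha> :: real
    and \<phi> :: "(real^'k) \<times> (real^'k) \<Rightarrow> real"
  assumes "sym_pos_def \<Sigma>"
    and "0 < \<alpha>" and "\<alpha> < 1"
    and "is_test \<phi>"
    and "unbiased_test \<Sigma> \<beta>0 \<alpha> \<phi>"
  shows "locally_unbiased_test \<Sigma> \<beta>0 \<alpha> \<phi>"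
proof -
  have \<phi>_meas: "\<phi> \<in> borel_measurable borel" and bounded: "\<And>z. 0 \<le> \<phi> z \<and> \<phi> z \<le> 1"
    using assms(4) unfolding is_test_def borel_prod by auto
  note deriv = DERIV_power_along_line[OF \<phi>_meas bounded]
  define u where "u \<mu> = (0 :: real^'k, D_mat \<Sigma> \<beta>0 \<beta>0 *v \<mu>)" for \<mu>
  define w where "w \<mu> = (C_mat \<Sigma> \<beta>0 *v \<mu>, D_slope \<Sigma> \<beta>0 *v \<mu>)" for \<mu>
  define power where "power \<mu> h = (LINT z|normal_pair (u \<mu> + h *\<^sub>R w \<mu>). \<phi> z)" for \<mu> h
  have law: "ST_law \<Sigma> \<beta>0 (\<beta>0 + h) \<mu> = normal_pair (u \<mu> + h *\<^sub>R w \<mu>)" for h \<mu>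
    unfolding u_def w_def by (rule ST_law_line)
  have null_law: "ST_law \<Sigma> \<beta>0 \<beta>0 \<mu> = normal_pair (u \<mu>)" for \<mu>
    using law[of 0 \<mu>] by simp
  have power_DERIV: "(power \<mu> has_real_derivative
      (LINT z|normal_pair (u \<mu>). \<phi> z * (w \<mu> \<bullet> (z - u \<mu>)))) (at 0)" for \<mu>
    unfolding power_def by (rule deriv(2))
  have power_ge: "power \<mu> h \<ge> \<alpha>" if "h \<noteq> 0" for \<mu> h
    using assms(5) that unfolding unbiased_test_def power_def law[symmetric] by simp
  have size: "power \<mu> 0 = \<alpha>" for \<mu>
  proof (rule antisym)
    show "power \<mu> 0 \<le> \<alpha>"
      using assms(5) unfolding unbiased_test_def power_def null_law by simp
    have "(power \<mu> \<longlongrightarrow> power \<mu> 0) (at 0)"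
      using DERIV_isCont[OF power_DERIV] by (simp add: isCont_def)
    then show "\<alpha> \<le> power \<mu> 0"
      by (rule tendsto_lowerbound) (auto simp: eventually_at_filter power_ge)
  qed
  then have null_power: "(LINT z|normal_pair (u \<mu>). \<phi> z) = \<alpha>" for \<mu>
    by (simp add: power_def)
  have "(LINT z|normal_pair (u \<mu>). \<phi> z * (fst z \<bullet> (C_mat \<Sigma> \<beta>0 *v \<mu>))) = 0" for \<mu>
  proof -
    define v where "v = (0 :: real^'k, D_slope \<Sigma> \<beta>0 *v \<mu>)"
    have full: "(LINT z|normal_pair (u \<mu>). \<phi> z * (w \<mu> \<bullet> (z - u \<mu>))) = 0"
    proof (rule DERIV_local_min[OF power_DERIV, of 1])
      show "\<forall>h. \<bar>0 - h\<bar> < 1 \<longrightarrow> power \<mu> 0 \<le> power \<mu> h"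
        using size power_ge by (metis order_refl)
    qed simp
    obtain \<nu> where \<nu>: "D_slope \<Sigma> \<beta>0 *v \<mu> = D_mat \<Sigma> \<beta>0 \<beta>0 *v \<nu>"
      using D_slope_in_range[OF assms(1)] .
    \<comment> \<open>Shifting the mean of \<open>T\<close> only is the same as moving the nuisance parameter.\<close>
    have "u \<mu> + h *\<^sub>R v = u (\<mu> + h *\<^sub>R \<nu>)" for h
      by (simp add: u_def v_def \<nu> matrix_vector_right_distrib matrix_vector_mult_scaleR)
    then have "((\<lambda>h. \<alpha>) has_real_derivative
        (LINT z|normal_pair (u \<mu>). \<phi> z * (v \<bullet> (z - u \<mu>)))) (at 0)"
      using deriv(2)[of "u \<mu>" v] by (simp add: null_power)
    then have nuisance: "(LINT z|normal_pair (u \<mu>). \<phi> z * (v \<bullet> (z - u \<mu>))) = 0"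
      using DERIV_unique DERIV_const by blast
    have "(LINT z|normal_pair (u \<mu>). \<phi> z * (fst z \<bullet> (C_mat \<Sigma> \<beta>0 *v \<mu>)))
        = (LINT z|normal_pair (u \<mu>). \<phi> z * (w \<mu> \<bullet> (z - u \<mu>)) - \<phi> z * (v \<bullet> (z - u \<mu>)))"
      by (intro Bochner_Integration.integral_cong)
        (auto simp: u_def v_def w_def inner_prod_def inner_commute algebra_simps)
    also have "\<dots> = 0"
      using full nuisance by (simp add: Bochner_Integration.integral_diff[OF deriv(1) deriv(1)])
    finally show ?thesis .
  qed
  then show ?thesis
    unfolding locally_unbiased_test_def null_law using null_power by blast
qed

end
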